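(* Let $f:\{0,1\}^n\times\{0,1\}^n\to[-1,1]$ and $\varepsilon\in(0,1]$, and suppose $\mathrm{rank}_{\varepsilon/2}(f)=r$. Then $\bar{\mathrm{D}}_\varepsilon(f)\le O(rn+r\log(1/\varepsilon))$.
   Context: $A_f$ is the $2^n\times 2^n$ real matrix with $(x,y)$ entry $f(x,y)$. The $\varepsilon$-approximate rank $\mathrm{rank}_\varepsilon(f)$ is the minimum rank of a real matrix $B$ with $\max_{x,y}|A_f(x,y)-B(x,y)|\le\varepsilon$. Distributed estimation: Alice holds a probability distribution $p$ on $\{0,1\}^n$, Bob holds a probability distribution $q$ on $\{0,1\}^n$, and they must output a value within additive error $\varepsilon$ of $\mathbb{E}_{x\sim p,y\sim q}[f(x,y)]$. $\bar{\mathrm{D}}_\varepsilon(f)$ is the minimum worst-case communication (in bits) of a deterministic protocol that does so for every input pair $(p,q)$. $O$ hides an absolute constant. *)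

theory Defs
  imports "HOL-Probability.Probability_Mass_Function" "HOL-Library.Extended_Real"
    "Jordan_Normal_Form.DL_Rank"
begin

definition cube :: "nat \<Rightarrow> bool list set" where
  "cube n = {x. length x = n}"

text \<open>Matrices are indexed by numbers below \<open>2 ^ n\<close>, so rows and columns are labelled by the
  bit strings of length \<open>n\<close> through a fixed enumeration of the cube.\<close>

definition bitstring :: "nat \<Rightarrow> nat \<Rightarrow> bool list" where
  "bitstring n i = List.n_lists n [False, True] ! i"

lemma bij_betw_bitstring: "bij_betw (bitstring n) {..<2 ^ n} (cube n)"
proof -
  have "bij_betw ((!) (List.n_lists n [False, True])) {..<length (List.n_lists n [False, True])}
          (set (List.n_lists n [False, True]))"
    by (intro bij_betw_nth distinct_n_lists) auto
  moreover have "set (List.n_lists n [False, True]) = cube n"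
    by (auto simp: set_n_lists cube_def)
  moreover have "bitstring n = (!) (List.n_lists n [False, True])"
    by (simp add: bitstring_def fun_eq_iff)
  ultimately show ?thesis
    by (simp add: length_n_lists numeral_2_eq_2)
qed

definition comm_matrix :: "nat \<Rightarrow> (bool list \<Rightarrow> bool list \<Rightarrow> real) \<Rightarrow> real mat" where
  "comm_matrix n f = mat (2 ^ n) (2 ^ n) (\<lambda>(i, j). f (bitstring n i) (bitstring n j))"

definition approx_rank :: "nat \<Rightarrow> real \<Rightarrow> (bool list \<Rightarrow> bool list \<Rightarrow> real) \<Rightarrow> nat" where
  "approx_rank n \<epsilon> f = Inf {vec_space.rank (2 ^ n) B | B.
     B \<in> carrier_mat (2 ^ n) (2 ^ n) \<and>
     (\<forall>i<2 ^ n. \<forall>j<2 ^ n. \<bar>comm_matrix n f $$ (i, j) - B $$ (i, j)\<bar> \<le> \<epsilon>)}"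

text \<open>A protocol is a binary tree. At an inner node its owner sends one bit, which depends on the
  owner's input only (the history is the position in the tree). The output is a function of the
  transcript, hence known to both parties.\<close>

datatype ('a, 'b) protocol =
    Output real
  | Alice "'a \<Rightarrow> bool" "('a, 'b) protocol" "('a, 'b) protocol"
  | Bob "'b \<Rightarrow> bool" "('a, 'b) protocol" "('a, 'b) protocol"

primrec run :: "('a, 'b) protocol \<Rightarrow> 'a \<Rightarrow> 'b \<Rightarrow> real" where
  "run (Output v) a b = v"
| "run (Alice s P Q) a b = (if s a then run P a b else run Q a b)"
| "run (Bob s P Q) a b = (if s b then run P a b else run Q a b)"

primrec cost :: "('a, 'b) protocol \<Rightarrow> nat" where
  "cost (Output v) = 0"
| "cost (Alice s P Q) = Suc (max (cost P) (cost Q))"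
| "cost (Bob s P Q) = Suc (max (cost P) (cost Q))"

definition dists :: "nat \<Rightarrow> bool list pmf set" where
  "dists n = {p. set_pmf p \<subseteq> cube n}"

definition estimates ::
    "nat \<Rightarrow> real \<Rightarrow> (bool list \<Rightarrow> bool list \<Rightarrow> real) \<Rightarrow> (bool list pmf, bool list pmf) protocol \<Rightarrow> bool" where
  "estimates n \<epsilon> f P \<longleftrightarrow> (\<forall>p\<in>dists n. \<forall>q\<in>dists n.
     \<bar>run P p q - measure_pmf.expectation (pair_pmf p q) (\<lambda>(x, y). f x y)\<bar> \<le> \<epsilon>)"

text \<open>Valued in \<open>enat\<close>, so that it would be infinite if no protocol existed.\<close>

definition D_bar :: "nat \<Rightarrow> real \<Rightarrow> (bool list \<Rightarrow> bool list \<Rightarrow> real) \<Rightarrow> enat" where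
  "D_bar n \<epsilon> f = Inf {enat (cost P) | P. estimates n \<epsilon> f P}"

end

theory Submission
  imports Defs "HOL-Library.Float"
begin

text \<open>Let \<open>B\<close> be a matrix of rank \<open>r\<close> that approximates \<open>f\<close> within \<open>\<epsilon> / 2\<close>. It has a barycentric
  spanner: \<open>r\<close> columns, forming a matrix \<open>U\<close>, such that \<open>B = U T\<close> with all entries of \<open>T\<close> in
  \<open>[-1, 1]\<close>. Hence the expectation \<open>p\<^sup>T B q\<close> is the inner product of \<open>\<alpha> = U\<^sup>T p\<close>, known to Alice, and
  \<open>\<beta> = T q\<close>, known to Bob. These vectors have length \<open>r \<le> 2 ^ n\<close> and entries bounded by \<open>2\<close> and \<open>1\<close>,
  so it suffices that Bob sends every entry of \<open>\<beta>\<close> to precision of order \<open>\<epsilon> / 2 ^ n\<close>, which takes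
  \<open>n + log (1 / \<epsilon>) + O(1)\<close> bits each, and that Alice answers with the rounded inner product. The
  cases \<open>n = 0\<close> and \<open>r = 0\<close> are separate because there the bound leaves no room for the additive
  constants.\<close>

unbundle no vec_syntax and no inner_syntax

subsection \<open>Barycentric spanners\<close>

lemma (in vec_space) ex_column_basis:
  assumes A: "A \<in> carrier_mat n nc"
  obtains C where "C \<in> carrier_mat n (rank A)" "distinct (cols C)"
    "set (cols C) \<subseteq> set (cols A)"
    "\<And>v. v \<in> set (cols A) \<Longrightarrow> \<exists>x\<in>carrier_vec (rank A). C *\<^sub>v x = v"
proof -
  let ?P = "\<lambda>T. T \<subseteq> set (cols A) \<and> lin_indpt T"
  have carrier: "set (cols A) \<subseteq> carrier_vec n" using cols_dim A by blast
  have "?P {}" by (simp add: finite_lin_indpt2)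
  then obtain S where max: "maximal S ?P"
    using maximal_exists_superset[of "set (cols A)" ?P "{}"] by auto
  then have S: "S \<subseteq> set (cols A)" "lin_indpt S" by (auto simp: maximal_def)
  have span: "v \<in> span S" if v: "v \<in> set (cols A)" for v
  proof (rule ccontr)
    assume not_span: "v \<notin> span S"
    then have "v \<notin> S" using span_mem[of S v] S carrier by auto
    moreover have "lin_indpt (S \<union> {v})"
      using lin_dep_iff_in_span[of S v] S carrier not_span v \<open>v \<notin> S\<close> by auto
    ultimately show False using S v max unfolding maximal_def by blast
  qed
  obtain vs where vs: "set vs = S" "distinct vs"
    using finite_distinct_list[of S] S(1) finite_subset by blast
  define C where "C = mat_of_cols n vs"
  have cols_C: "cols C = vs" using vs(1) S(1) carrier by (simp add: C_def)
  have C: "C \<in> carrier_mat n (rank A)"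
    using rank_card_indpt[OF A max] vs distinct_card[of vs]
    by (intro carrier_matI) (simp_all add: C_def)
  have "\<exists>x\<in>carrier_vec (rank A). C *\<^sub>v x = v" if v: "v \<in> set (cols A)" for v
  proof -
    obtain a where "lincomb a (set (cols C)) = v"
      using finite_in_span[of S v] span[OF v] S(1) carrier vs(1) cols_C by auto
    then have "C *\<^sub>v vec (rank A) (\<lambda>i. a (col C i)) = v"
      using mat_mult_eq_lincomb[OF C] vs(2) cols_C by simp
    then show ?thesis by (intro bexI) auto
  qed
  then show ?thesis using that[OF C] cols_C vs S(1) by simp
qed

definition select_cols :: "'a mat \<Rightarrow> nat \<Rightarrow> (nat \<Rightarrow> nat) \<Rightarrow> 'a mat" where
  "select_cols A r k = mat (dim_row A) r (\<lambda>(i, l). A $$ (i, k l))"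

lemma dim_select_cols [simp]:
  "dim_row (select_cols A r k) = dim_row A" "dim_col (select_cols A r k) = r"
  by (simp_all add: select_cols_def)

lemma select_cols_carrier [simp]: "A \<in> carrier_mat n nc \<Longrightarrow> select_cols A r k \<in> carrier_mat n r"
  by (intro carrier_matI) auto

lemma index_select_cols [simp]:
  "i < dim_row A \<Longrightarrow> l < r \<Longrightarrow> select_cols A r k $$ (i, l) = A $$ (i, k l)"
  by (simp add: select_cols_def)

lemma col_select_cols:
  "l < r \<Longrightarrow> k l < dim_col A \<Longrightarrow> col (select_cols A r k) l = col A (k l)"
  by (intro eq_vecI) auto

lemma select_cols_mult:
  assumes "A \<in> carrier_mat n m" "B \<in> carrier_mat m nc" "\<And>l. l < r \<Longrightarrow> k l < nc"
  shows "select_cols (A * B) r k = A * select_cols B r k"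
  using assms by (intro mat_col_eqI) (auto simp: col_select_cols)

lemma replace_col_select_cols:
  assumes "y < dim_col A"
  shows "replace_col (select_cols A r k) (col A y) i = select_cols A r (k(i := y))"
  using assms by (intro eq_matI) (auto simp: replace_col_def)

lemma ex_select_cols_max_det:
  fixes A :: "'a :: linordered_idom mat"
  assumes j: "\<And>i. i < r \<Longrightarrow> j i < nc"
  obtains k where "\<And>i. i < r \<Longrightarrow> k i < nc"
    "\<And>l. (\<And>i. i < r \<Longrightarrow> l i < nc) \<Longrightarrow> \<bar>det (select_cols A r l)\<bar> \<le> \<bar>det (select_cols A r k)\<bar>"
proof -
  define K where "K = {..<r} \<rightarrow>\<^sub>E {..<nc}"
  let ?d = "\<lambda>l. \<bar>det (select_cols A r l)\<bar>"
  have K: "restrict l {..<r} \<in> K" if "\<And>i. i < r \<Longrightarrow> l i < nc" for l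
    using that by (auto simp: K_def)
  have fin: "finite K" unfolding K_def by (intro finite_PiE) auto
  obtain k where k: "k \<in> K" and max: "Max (?d ` K) = ?d k"
    using obtains_MAX[OF fin, of ?d] K[of j, OF j] by blast
  have "?d l \<le> ?d k" if "\<And>i. i < r \<Longrightarrow> l i < nc" for l
  proof -
    have "select_cols A r l = select_cols A r (restrict l {..<r})" by (intro eq_matI) auto
    then show ?thesis using fin K[of l, OF that] by (simp flip: max)
  qed
  moreover have "k i < nc" if "i < r" for i using k that by (auto simp: K_def)
  ultimately show ?thesis using that by blast
qed

text \<open>By Cramer's rule the coefficients of a column with respect to the columns of maximal determinant
  are quotients of such determinants by the maximal one.\<close>

lemma ex_barycentric_spanner_full_rank:
  fixes A :: "'a :: linordered_field mat"
  assumes A: "A \<in> carrier_mat r nc"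
    and j: "\<And>i. i < r \<Longrightarrow> j i < nc" and det_j: "det (select_cols A r j) \<noteq> 0"
  obtains k T where "\<And>i. i < r \<Longrightarrow> k i < nc" "T \<in> carrier_mat r nc"
    "A = select_cols A r k * T" "\<And>i y. i < r \<Longrightarrow> y < nc \<Longrightarrow> \<bar>T $$ (i, y)\<bar> \<le> 1"
proof -
  obtain k where k: "\<And>i. i < r \<Longrightarrow> k i < nc" and det_le: "\<And>l. (\<And>i. i < r \<Longrightarrow> l i < nc) \<Longrightarrow>
      \<bar>det (select_cols A r l)\<bar> \<le> \<bar>det (select_cols A r k)\<bar>"
    using ex_select_cols_max_det[of r j nc A, OF j] by blast
  define M where "M = select_cols A r k"
  have M: "M \<in> carrier_mat r r" using A by (simp add: M_def)
  have det_M: "det M \<noteq> 0" using det_le[OF j] det_j by (auto simp: M_def)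
  obtain M' where M': "M' \<in> carrier_mat r r" "M * M' = 1\<^sub>m r"
    using det_non_zero_imp_unit[OF M det_M] by (auto simp: Units_def ring_mat_def)
  have T: "M' * A \<in> carrier_mat r nc" using M' A by simp
  have A_eq: "A = M * (M' * A)" using assoc_mult_mat[OF M M'(1) A] M'(2) A by simp
  have T_le: "\<bar>(M' * A) $$ (i, y)\<bar> \<le> 1" if i: "i < r" and y: "y < nc" for i y
  proof -
    define z where "z = col (M' * A) y"
    have z: "z \<in> carrier_vec r" using T by (metis col_carrier_vec y z_def)
    have "M *\<^sub>v z = col A y" using col_mult2[OF M T y] A_eq by (simp add: z_def)
    then have "z $ i * det M = det (select_cols A r (k(i := y)))"
      using cramer_lemma_mat[OF M z i] replace_col_select_cols[of y A r k i] y A by (simp add: M_def)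
    moreover have "\<bar>det (select_cols A r (k(i := y)))\<bar> \<le> \<bar>det M\<bar>"
      unfolding M_def using k y by (intro det_le) simp
    ultimately have "\<bar>z $ i\<bar> * \<bar>det M\<bar> \<le> 1 * \<bar>det M\<bar>" by (simp flip: abs_mult)
    then have "\<bar>z $ i\<bar> \<le> 1" using det_M by (simp only: mult_le_cancel_right zero_less_abs_iff) auto
    then show ?thesis using i y T by (simp add: z_def del: index_mult_mat)
  qed
  show ?thesis
    by (rule that[of k "M' * A"]) (fact k T T_le A_eq[unfolded M_def])+
qed

lemma mult_mat_vec_unit_vec:
  fixes A :: "'a :: semiring_1 mat"
  assumes "A \<in> carrier_mat n nc" "i < nc"
  shows "A *\<^sub>v unit_vec nc i = col A i"
  using assms by (intro eq_vecI) auto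

lemma ex_coordinates_unit_on_cols:
  fixes C :: "'a :: semiring_1 mat"
  assumes C: "C \<in> carrier_mat n nc" "distinct (cols C)" and v: "\<exists>x\<in>carrier_vec nc. C *\<^sub>v x = v"
  shows "\<exists>x\<in>carrier_vec nc. C *\<^sub>v x = v \<and> (\<forall>i<nc. col C i = v \<longrightarrow> x = unit_vec nc i)"
proof (cases "\<exists>i<nc. col C i = v")
  case True
  then obtain i where i: "i < nc" "col C i = v" by blast
  have "l = i" if "l < nc" "col C l = v" for l
    using that i C nth_eq_iff_index_eq[of "cols C" l i] by simp
  moreover have "C *\<^sub>v unit_vec nc i = v" using mult_mat_vec_unit_vec[OF C(1) i(1)] i(2) by simp
  ultimately show ?thesis by (intro bexI[of _ "unit_vec nc i"]) auto
next
  case False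
  then show ?thesis using v by blast
qed

lemma (in vec_space) rank_factorization:
  assumes A: "A \<in> carrier_mat n nc" and r: "rank A = r"
  obtains C R j where "C \<in> carrier_mat n r" "R \<in> carrier_mat r nc" "A = C * R"
    "\<And>i. i < r \<Longrightarrow> j i < nc" "select_cols R r j = 1\<^sub>m r"
proof -
  obtain C where C: "C \<in> carrier_mat n r" "distinct (cols C)" "set (cols C) \<subseteq> set (cols A)"
    and coords: "\<And>v. v \<in> set (cols A) \<Longrightarrow> \<exists>x\<in>carrier_vec r. C *\<^sub>v x = v"
    using ex_column_basis[OF A] unfolding r by blast
  have "\<exists>y<nc. col A y = col C i" if "i < r" for i
  proof -
    have "col C i \<in> set (cols A)" using that C nth_mem[of i "cols C"] by auto
    then show ?thesis using A by (auto simp: cols_def)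
  qed
  then obtain j where j: "\<And>i. i < r \<Longrightarrow> j i < nc \<and> col A (j i) = col C i" by metis
  have "\<exists>x. x \<in> carrier_vec r \<and> C *\<^sub>v x = col A y \<and>
      (\<forall>i<r. col C i = col A y \<longrightarrow> x = unit_vec r i)" if "y < nc" for y
    using ex_coordinates_unit_on_cols[OF C(1,2) coords, of "col A y"] that A
    by (auto simp: cols_def)
  then obtain x where x: "\<And>y. y < nc \<Longrightarrow> x y \<in> carrier_vec r \<and> C *\<^sub>v x y = col A y \<and>
      (\<forall>i<r. col C i = col A y \<longrightarrow> x y = unit_vec r i)" by metis
  define R where "R = mat_of_cols r (map x [0..<nc])"
  have R: "R \<in> carrier_mat r nc" by (intro carrier_matI) (simp_all add: R_def)
  have col_R: "col R y = x y" if "y < nc" for y using that x by (simp add: R_def)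
  have "A = C * R"
  proof (rule mat_col_eqI)
    fix y assume "y < dim_col (C * R)"
    then show "col A y = col (C * R) y" using R col_mult2[OF C(1) R, of y] x col_R by simp
  qed (use A C(1) R in auto)
  moreover have "select_cols R r j = 1\<^sub>m r"
    using R j x col_R by (intro mat_col_eqI) (auto simp: col_select_cols)
  ultimately show ?thesis using that C(1) R j by blast
qed

lemma ex_barycentric_spanner:
  fixes A :: "'a :: linordered_field mat"
  assumes A: "A \<in> carrier_mat n nc" and r: "vec_space.rank n A = r"
  obtains k T where "r \<le> nc" "\<And>i. i < r \<Longrightarrow> k i < nc" "T \<in> carrier_mat r nc"
    "A = select_cols A r k * T" "\<And>i y. i < r \<Longrightarrow> y < nc \<Longrightarrow> \<bar>T $$ (i, y)\<bar> \<le> 1"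
proof -
  interpret vec_space "TYPE('a)" n .
  obtain C R j where C: "C \<in> carrier_mat n r" and R: "R \<in> carrier_mat r nc" and A_eq: "A = C * R"
    and j: "\<And>i. i < r \<Longrightarrow> j i < nc" and unit: "select_cols R r j = 1\<^sub>m r"
    using rank_factorization[OF A r] by blast
  have det_j: "det (select_cols R r j) \<noteq> 0" by (simp add: unit)
  obtain k T where k: "\<And>i. i < r \<Longrightarrow> k i < nc" and T: "T \<in> carrier_mat r nc"
    and R_eq: "R = select_cols R r k * T"
    and T_le: "\<And>i y. i < r \<Longrightarrow> y < nc \<Longrightarrow> \<bar>T $$ (i, y)\<bar> \<le> 1"
    using ex_barycentric_spanner_full_rank[OF R j det_j] by blast
  have spanner_eq: "A = select_cols A r k * T"
    using select_cols_mult[OF C R k] assoc_mult_mat[OF C select_cols_carrier[OF R] T]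
    by (simp flip: A_eq R_eq)
  have r_le: "r \<le> nc" using rank_le_nc[OF A] r by simp
  show ?thesis by (rule that[of k T]) (fact r_le k T spanner_eq T_le)+
qed

subsection \<open>Approximate rank\<close>

lemma comm_matrix_carrier [simp]: "comm_matrix n f \<in> carrier_mat (2 ^ n) (2 ^ n)"
  by (simp add: comm_matrix_def)

lemma abs_comm_matrix_le:
  assumes "\<forall>x\<in>cube n. \<forall>y\<in>cube n. \<bar>f x y\<bar> \<le> b" "i < 2 ^ n" "j < 2 ^ n"
  shows "\<bar>comm_matrix n f $$ (i, j)\<bar> \<le> b"
  using assms bij_betw_apply[OF bij_betw_bitstring[of n]] by (simp add: comm_matrix_def)

lemma approx_rank_attained:
  assumes "\<epsilon> \<ge> 0"
  obtains B where "B \<in> carrier_mat (2 ^ n) (2 ^ n)"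
    "\<And>i j. i < 2 ^ n \<Longrightarrow> j < 2 ^ n \<Longrightarrow> \<bar>comm_matrix n f $$ (i, j) - B $$ (i, j)\<bar> \<le> \<epsilon>"
    "vec_space.rank (2 ^ n) B = approx_rank n \<epsilon> f"
proof -
  let ?S = "{vec_space.rank (2 ^ n) B | B. B \<in> carrier_mat (2 ^ n) (2 ^ n) \<and>
     (\<forall>i<2 ^ n. \<forall>j<2 ^ n. \<bar>comm_matrix n f $$ (i, j) - B $$ (i, j)\<bar> \<le> \<epsilon>)}"
  have "vec_space.rank (2 ^ n) (comm_matrix n f) \<in> ?S"
    using assms comm_matrix_carrier[of n f] by auto
  then have "approx_rank n \<epsilon> f \<in> ?S" unfolding approx_rank_def by (intro Inf_nat_def1) blast
  then show ?thesis using that by auto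
qed

subsection \<open>Distributions as stochastic vectors\<close>

definition stochastic_vec :: "real vec \<Rightarrow> bool" where
  "stochastic_vec v \<longleftrightarrow> (\<forall>i<dim_vec v. 0 \<le> v $ i) \<and> (\<Sum>i<dim_vec v. v $ i) = 1"

lemma abs_scalar_prod_stochastic_vec_le:
  assumes "stochastic_vec v" "\<And>i. i < dim_vec v \<Longrightarrow> \<bar>w $ i\<bar> \<le> b"
  shows "\<bar>w \<bullet> v\<bar> \<le> b"
  using convex_sum_bound_le[of "{..<dim_vec v}" "($) v" "($) w" 0 b] assms
  by (simp add: stochastic_vec_def scalar_prod_def atLeast0LessThan)

lemma abs_mult_mat_vec_stochastic_vec_le:
  assumes "stochastic_vec v" "v \<in> carrier_vec (dim_col A)" "i < dim_row A"
    "\<And>j. j < dim_col A \<Longrightarrow> \<bar>A $$ (i, j)\<bar> \<le> b"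
  shows "\<bar>(A *\<^sub>v v) $ i\<bar> \<le> b"
  using assms by (auto intro!: abs_scalar_prod_stochastic_vec_le)

lemma abs_bilinear_stochastic_vec_le:
  assumes A: "A \<in> carrier_mat m n" and u: "stochastic_vec u" "u \<in> carrier_vec m"
    and v: "stochastic_vec v" "v \<in> carrier_vec n"
    and A_le: "\<And>i j. i < m \<Longrightarrow> j < n \<Longrightarrow> \<bar>A $$ (i, j)\<bar> \<le> b"
  shows "\<bar>u \<bullet> (A *\<^sub>v v)\<bar> \<le> b"
proof -
  have "\<bar>(A *\<^sub>v v) \<bullet> u\<bar> \<le> b"
    using assms by (intro abs_scalar_prod_stochastic_vec_le abs_mult_mat_vec_stochastic_vec_le) auto
  then show ?thesis using comm_scalar_prod[OF u(2) mult_mat_vec_carrier[OF A v(2)]] by simp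
qed

definition pmf_vec :: "nat \<Rightarrow> bool list pmf \<Rightarrow> real vec" where
  "pmf_vec n p = vec (2 ^ n) (\<lambda>i. pmf p (bitstring n i))"

lemma pmf_vec_carrier [simp]: "pmf_vec n p \<in> carrier_vec (2 ^ n)"
  by (simp add: pmf_vec_def)

lemma finite_cube: "finite (cube n)"
  using bij_betw_finite[OF bij_betw_bitstring[of n]] by simp

lemma stochastic_pmf_vec:
  assumes "p \<in> dists n"
  shows "stochastic_vec (pmf_vec n p)"
proof -
  have "(\<Sum>i<2 ^ n. pmf p (bitstring n i)) = (\<Sum>x\<in>cube n. pmf p x)"
    by (rule sum.reindex_bij_betw[OF bij_betw_bitstring])
  also have "\<dots> = 1"
    using assms finite_cube by (intro sum_pmf_eq_1) (auto simp: dists_def)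
  finally show ?thesis by (simp add: stochastic_vec_def pmf_vec_def)
qed

lemma expectation_eq_bilinear_comm_matrix:
  assumes p: "p \<in> dists n" and q: "q \<in> dists n"
  shows "measure_pmf.expectation (pair_pmf p q) (\<lambda>(x, y). f x y) =
    pmf_vec n p \<bullet> (comm_matrix n f *\<^sub>v pmf_vec n q)"
proof -
  let ?b = "bitstring n"
  have "measure_pmf.expectation (pair_pmf p q) (\<lambda>(x, y). f x y) =
      (\<Sum>z\<in>cube n \<times> cube n. (case z of (x, y) \<Rightarrow> f x y) * pmf (pair_pmf p q) z)"
    using p q finite_cube by (intro integral_measure_pmf_real) (auto simp: dists_def)
  also have "\<dots> = (\<Sum>x\<in>cube n. \<Sum>y\<in>cube n. f x y * pmf (pair_pmf p q) (x, y))"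
    by (simp add: sum.cartesian_product case_prod_unfold)
  also have "\<dots> = (\<Sum>i<2 ^ n. \<Sum>y\<in>cube n. f (?b i) y * pmf (pair_pmf p q) (?b i, y))"
    by (rule sum.reindex_bij_betw[OF bij_betw_bitstring, symmetric])
  also have "\<dots> = (\<Sum>i<2 ^ n. \<Sum>j<2 ^ n. f (?b i) (?b j) * pmf (pair_pmf p q) (?b i, ?b j))"
    by (intro sum.cong refl sum.reindex_bij_betw[OF bij_betw_bitstring, symmetric])
  also have "\<dots> = pmf_vec n p \<bullet> (comm_matrix n f *\<^sub>v pmf_vec n q)"
    by (simp add: scalar_prod_def pmf_vec_def comm_matrix_def pmf_pair sum_distrib_left
        atLeast0LessThan mult_ac)
  finally show ?thesis .
qed

lemma bilinear_mult_mat: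
  fixes U T :: "'a :: comm_semiring_0 mat"
  assumes U: "U \<in> carrier_mat m r" and T: "T \<in> carrier_mat r n"
    and u: "u \<in> carrier_vec m" and v: "v \<in> carrier_vec n"
  shows "u \<bullet> ((U * T) *\<^sub>v v) = (\<Sum>i<r. (U\<^sup>T *\<^sub>v u) $ i * (T *\<^sub>v v) $ i)"
proof -
  have T_v: "T *\<^sub>v v \<in> carrier_vec r" using T v by simp
  have "u \<bullet> ((U * T) *\<^sub>v v) = (U\<^sup>T *\<^sub>v u) \<bullet> (T *\<^sub>v v)"
    using transpose_vec_mult_scalar[OF U T_v u] assoc_mult_mat_vec[OF U T v] by simp
  then show ?thesis using T by (simp add: scalar_prod_def atLeast0LessThan)
qed

subsection \<open>Approximating the expectation by an inner product\<close>

lemma abs_bilinear_diff_expectation_le: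
  assumes p: "p \<in> dists n" and q: "q \<in> dists n" and B: "B \<in> carrier_mat (2 ^ n) (2 ^ n)"
    and B_approx: "\<And>i j. i < 2 ^ n \<Longrightarrow> j < 2 ^ n \<Longrightarrow> \<bar>comm_matrix n f $$ (i, j) - B $$ (i, j)\<bar> \<le> \<epsilon>"
  shows "\<bar>pmf_vec n p \<bullet> (B *\<^sub>v pmf_vec n q) -
    measure_pmf.expectation (pair_pmf p q) (\<lambda>(x, y). f x y)\<bar> \<le> \<epsilon>"
proof -
  let ?F = "comm_matrix n f"
  have "\<bar>pmf_vec n p \<bullet> ((B - ?F) *\<^sub>v pmf_vec n q)\<bar> \<le> \<epsilon>"
    using B_approx carrier_matD[OF comm_matrix_carrier[of n f]]
    by (intro abs_bilinear_stochastic_vec_le[OF minus_carrier_mat[OF comm_matrix_carrier]]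
          stochastic_pmf_vec p q) (auto simp: abs_minus_commute)
  moreover have "pmf_vec n p \<bullet> ((B - ?F) *\<^sub>v pmf_vec n q) =
      pmf_vec n p \<bullet> (B *\<^sub>v pmf_vec n q) - pmf_vec n p \<bullet> (?F *\<^sub>v pmf_vec n q)"
    using mult_mat_vec_carrier[OF B pmf_vec_carrier[of n q]]
      mult_mat_vec_carrier[OF comm_matrix_carrier[of n f] pmf_vec_carrier[of n q]]
    by (simp add: minus_mult_distrib_mat_vec[OF B comm_matrix_carrier]
        scalar_prod_minus_distrib[OF pmf_vec_carrier])
  ultimately show ?thesis by (simp add: expectation_eq_bilinear_comm_matrix[OF p q])
qed

lemma ex_inner_product_approx_expectation:
  assumes f: "\<forall>x\<in>cube n. \<forall>y\<in>cube n. \<bar>f x y\<bar> \<le> b" and \<epsilon>: "\<epsilon> \<ge> 0"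
  obtains \<alpha> \<beta> where "approx_rank n \<epsilon> f \<le> 2 ^ n"
    "\<And>p i. p \<in> dists n \<Longrightarrow> i < approx_rank n \<epsilon> f \<Longrightarrow> \<bar>\<alpha> p i\<bar> \<le> b + \<epsilon>"
    "\<And>q i. q \<in> dists n \<Longrightarrow> i < approx_rank n \<epsilon> f \<Longrightarrow> \<bar>\<beta> q i\<bar> \<le> 1"
    "\<And>p q. p \<in> dists n \<Longrightarrow> q \<in> dists n \<Longrightarrow>
      \<bar>(\<Sum>i<approx_rank n \<epsilon> f. \<alpha> p i * \<beta> q i) -
        measure_pmf.expectation (pair_pmf p q) (\<lambda>(x, y). f x y)\<bar> \<le> \<epsilon>"
proof -
  let ?F = "comm_matrix n f" and ?N = "2 ^ n :: nat"
  define r where "r = approx_rank n \<epsilon> f"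
  obtain B where B: "B \<in> carrier_mat ?N ?N" and rank_B: "vec_space.rank ?N B = r"
    and F_B: "\<And>i j. i < ?N \<Longrightarrow> j < ?N \<Longrightarrow> \<bar>?F $$ (i, j) - B $$ (i, j)\<bar> \<le> \<epsilon>"
    using approx_rank_attained[OF \<epsilon>] unfolding r_def by metis
  obtain k T where r_le: "r \<le> ?N" and k: "\<And>i. i < r \<Longrightarrow> k i < ?N" and T: "T \<in> carrier_mat r ?N"
    and B_eq: "B = select_cols B r k * T"
    and T_le: "\<And>i y. i < r \<Longrightarrow> y < ?N \<Longrightarrow> \<bar>T $$ (i, y)\<bar> \<le> 1"
    using ex_barycentric_spanner[OF B rank_B] by metis
  define U where "U = select_cols B r k"
  have U: "U \<in> carrier_mat ?N r" using B by (simp add: U_def)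
  have B_le: "\<bar>B $$ (i, j)\<bar> \<le> b + \<epsilon>" if "i < ?N" "j < ?N" for i j
    using abs_comm_matrix_le[OF f that] F_B[OF that] by linarith
  define \<alpha> where "\<alpha> p = U\<^sup>T *\<^sub>v pmf_vec n p" for p
  define \<beta> where "\<beta> q = T *\<^sub>v pmf_vec n q" for q
  have bilinear_B: "pmf_vec n p \<bullet> (B *\<^sub>v pmf_vec n q) = (\<Sum>i<r. \<alpha> p $ i * \<beta> q $ i)" for p q
    using bilinear_mult_mat[OF U T pmf_vec_carrier[of n p] pmf_vec_carrier[of n q]] B_eq
    by (simp add: U_def \<alpha>_def \<beta>_def)
  show ?thesis
  proof (rule that[of "\<lambda>p. ($) (\<alpha> p)" "\<lambda>q. ($) (\<beta> q)"], fold r_def)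
    show "r \<le> ?N" by (rule r_le)
    show "\<bar>\<alpha> p $ i\<bar> \<le> b + \<epsilon>" if "p \<in> dists n" "i < r" for p i
      unfolding \<alpha>_def using that B k B_le
      by (intro abs_mult_mat_vec_stochastic_vec_le stochastic_pmf_vec) (auto simp: U_def)
    show "\<bar>\<beta> q $ i\<bar> \<le> 1" if "q \<in> dists n" "i < r" for q i
      unfolding \<beta>_def using that T T_le
      by (intro abs_mult_mat_vec_stochastic_vec_le stochastic_pmf_vec) auto
    fix p q assume p: "p \<in> dists n" and q: "q \<in> dists n"
    show "\<bar>(\<Sum>i<r. \<alpha> p $ i * \<beta> q $ i) -
        measure_pmf.expectation (pair_pmf p q) (\<lambda>(x, y). f x y)\<bar> \<le> \<epsilon>"
      using abs_bilinear_diff_expectation_le[OF p q B F_B] bilinear_B by simp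
  qed
qed

subsection \<open>Protocols\<close>

lemma ex_protocol_Bob_sends:
  assumes "finite S" "card S \<le> 2 ^ k" "\<And>s. s \<in> S \<Longrightarrow> cost (P s) \<le> c"
  shows "\<exists>Q. cost Q \<le> k + c \<and> (\<forall>a b. g b \<in> S \<longrightarrow> run Q a b = run (P (g b)) a b)"
  using assms
proof (induction k arbitrary: S)
  case 0
  then consider (empty) "S = {}" | (singleton) s where "S = {s}"
    by (auto simp: card_le_Suc0_iff_eq)
  then show ?case
  proof cases
    case empty
    then show ?thesis by (intro exI[of _ "Output 0"]) auto
  next
    case singleton
    then show ?thesis using 0 by (intro exI[of _ "P s"]) auto
  qed
next
  case (Suc k)
  obtain T where T: "T \<subseteq> S" "card T = min (card S) (2 ^ k)"
    by (meson min.cobounded1 obtain_subset_with_card_n)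
  have "card (S - T) = card S - card T"
    using T Suc.prems by (simp add: card_Diff_subset finite_subset)
  then have "card (S - T) \<le> 2 ^ k" using T Suc.prems(2) by auto
  then obtain Q2 where Q2: "cost Q2 \<le> k + c"
      "\<And>a b. g b \<in> S - T \<Longrightarrow> run Q2 a b = run (P (g b)) a b"
    using Suc.IH[of "S - T"] Suc.prems by auto
  obtain Q1 where Q1: "cost Q1 \<le> k + c" "\<And>a b. g b \<in> T \<Longrightarrow> run Q1 a b = run (P (g b)) a b"
    using Suc.IH[of T] T Suc.prems by (auto intro: finite_subset)
  show ?case
    using Q1 Q2 by (intro exI[of _ "Bob (\<lambda>b. g b \<in> T) Q1 Q2"]) auto
qed

primrec swap_roles :: "('a, 'b) protocol \<Rightarrow> ('b, 'a) protocol" where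
  "swap_roles (Output v) = Output v"
| "swap_roles (Alice s P Q) = Bob s (swap_roles P) (swap_roles Q)"
| "swap_roles (Bob s P Q) = Alice s (swap_roles P) (swap_roles Q)"

lemma run_swap_roles: "run (swap_roles P) b a = run P a b"
  by (induction P) auto

lemma cost_swap_roles: "cost (swap_roles P) = cost P"
  by (induction P) auto

lemma finite_round_down_image: "finite (round_down (int k) ` {- (2 ^ c)..2 ^ c})"
  and card_round_down_image_le: "card (round_down (int k) ` {- (2 ^ c)..2 ^ c}) \<le> 2 ^ (k + c + 2)"
proof -
  define I :: "int set" where "I = {- (2 ^ (k + c))..2 ^ (k + c)}"
  have "\<lfloor>x * 2 ^ k\<rfloor> \<in> I" if "x \<in> {- (2 ^ c)..2 ^ c}" for x :: real
  proof -
    have "- (2 ^ c) * 2 ^ k \<le> x * 2 ^ k" "x * 2 ^ k \<le> 2 ^ c * 2 ^ k"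
      using that by (intro mult_right_mono; simp)+
    then have "- (2 ^ (k + c)) \<le> x * 2 ^ k" "x * 2 ^ k \<le> 2 ^ (k + c)"
      by (simp_all add: power_add mult.commute)
    then show ?thesis by (simp add: I_def le_floor_iff floor_le_iff)
  qed
  then have sub: "round_down (int k) ` {- (2 ^ c)..2 ^ c} \<subseteq> (\<lambda>i. of_int i * 2 powr - real k) ` I"
    by (auto simp: round_down_def powr_realpow)
  then show "finite (round_down (int k) ` {- (2 ^ c)..2 ^ c})"
    by (rule finite_subset) (simp add: I_def)
  have "card (round_down (int k) ` {- (2 ^ c)..2 ^ c}) \<le> card I"
    using sub by (rule surj_card_le[rotated]) (simp add: I_def)
  also have "\<dots> = 2 * 2 ^ (k + c) + 1" by (simp add: I_def nat_add_distrib nat_mult_distrib nat_power_eq)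
  also have "\<dots> \<le> 2 ^ (k + c + 2)" by simp
  finally show "card (round_down (int k) ` {- (2 ^ c)..2 ^ c}) \<le> 2 ^ (k + c + 2)" .
qed

lemma abs_round_down_diff_le: "\<bar>round_down (int k) x - x\<bar> \<le> 1 / 2 ^ k"
  using round_down_correct[of x "int k"]
  by (simp add: powr_minus powr_realpow inverse_eq_divide)

lemma ex_protocol_Alice_rounds:
  "\<exists>Q. cost Q \<le> k + c + 2 \<and> (\<forall>a b. \<bar>v a\<bar> \<le> 2 ^ c \<longrightarrow> \<bar>run Q a b - v a\<bar> \<le> 1 / 2 ^ k)"
proof -
  let ?h = "round_down (int k)"
  obtain Q :: "('b, 'a) protocol" where Q: "cost Q \<le> k + c + 2"
      "\<And>b a. ?h (v a) \<in> ?h ` {- (2 ^ c)..2 ^ c} \<Longrightarrow> run Q b a = ?h (v a)"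
    using ex_protocol_Bob_sends[OF finite_round_down_image[of k c] card_round_down_image_le,
        where P = Output and c = "0" and g = "\<lambda>a. ?h (v a)"] by auto
  have "\<bar>run (swap_roles Q) a b - v a\<bar> \<le> 1 / 2 ^ k" if "\<bar>v a\<bar> \<le> 2 ^ c" for a b
    using Q(2)[of a b] abs_round_down_diff_le that by (simp add: run_swap_roles abs_le_iff)
  then show ?thesis using Q(1) cost_swap_roles by metis
qed

lemma abs_sum_mult_diff_le:
  fixes u v w :: "'i \<Rightarrow> real" and A \<delta> :: real
  assumes "\<And>i. i \<in> I \<Longrightarrow> \<bar>u i\<bar> \<le> A" "\<And>i. i \<in> I \<Longrightarrow> \<bar>v i - w i\<bar> \<le> \<delta>"
  shows "\<bar>(\<Sum>i\<in>I. u i * v i) - (\<Sum>i\<in>I. u i * w i)\<bar> \<le> real (card I) * (A * \<delta>)"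
proof -
  have "\<bar>u i * (v i - w i)\<bar> \<le> A * \<delta>" if "i \<in> I" for i
    unfolding abs_mult using assms[OF that] by (intro mult_mono) auto
  then have "(\<Sum>i\<in>I. \<bar>u i * (v i - w i)\<bar>) \<le> real (card I) * (A * \<delta>)"
    by (intro sum_bounded_above)
  then show ?thesis
    using sum_abs[of "\<lambda>i. u i * (v i - w i)" I] by (simp add: right_diff_distrib sum_subtractf)
qed

lemma abs_sum_mult_le_power:
  fixes u v :: "'i \<Rightarrow> real"
  assumes "card I \<le> 2 ^ m" "\<And>i. i \<in> I \<Longrightarrow> \<bar>u i\<bar> \<le> 2 ^ c" "\<And>i. i \<in> I \<Longrightarrow> \<bar>v i\<bar> \<le> 2 ^ d"
  shows "\<bar>\<Sum>i\<in>I. u i * v i\<bar> \<le> 2 ^ (m + c + d)"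
proof -
  have "\<bar>\<Sum>i\<in>I. u i * v i\<bar> \<le> real (card I) * (2 ^ c * 2 ^ d)"
    using abs_sum_mult_diff_le[of I u _ v "\<lambda>_. 0"] assms(2,3) by simp
  also have "\<dots> \<le> 2 ^ m * (2 ^ c * 2 ^ d)"
    using assms(1) by (intro mult_right_mono) auto
  finally show ?thesis by (simp add: power_add mult.assoc)
qed

lemma abs_sum_mult_round_down_diff_le:
  fixes u v :: "'i \<Rightarrow> real"
  assumes "card I \<le> 2 ^ m" "\<And>i. i \<in> I \<Longrightarrow> \<bar>u i\<bar> \<le> 2 ^ c"
  shows "\<bar>(\<Sum>i\<in>I. u i * round_down (int (m + c + l)) (v i)) - (\<Sum>i\<in>I. u i * v i)\<bar> \<le> 1 / 2 ^ l"
proof -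
  have "\<bar>(\<Sum>i\<in>I. u i * round_down (int (m + c + l)) (v i)) - (\<Sum>i\<in>I. u i * v i)\<bar>
      \<le> real (card I) * (2 ^ c * (1 / 2 ^ (m + c + l)))"
    by (rule abs_sum_mult_diff_le[OF assms(2) abs_round_down_diff_le])
  also have "\<dots> \<le> 2 ^ m * (2 ^ c * (1 / 2 ^ (m + c + l)))"
    using assms(1) by (intro mult_right_mono) auto
  also have "\<dots> = 1 / 2 ^ l" by (simp add: power_add)
  finally show ?thesis .
qed

lemma ex_protocol_Bob_sends_rounded:
  fixes \<beta> :: "'b \<Rightarrow> 'i \<Rightarrow> real" and P :: "('i \<Rightarrow> real) \<Rightarrow> ('a, 'b) protocol"
  assumes "finite I" and cost_P: "\<And>s. cost (P s) \<le> c"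
  shows "\<exists>Q. cost Q \<le> (k + d + 2) * card I + c \<and> (\<forall>a b. (\<forall>i\<in>I. \<bar>\<beta> b i\<bar> \<le> 2 ^ d) \<longrightarrow>
    run Q a b = run (P (\<lambda>i\<in>I. round_down (int k) (\<beta> b i))) a b)"
proof -
  define R where "R = round_down (int k) ` {- (2 ^ d)..2 ^ d}"
  define msg where "msg b = (\<lambda>i\<in>I. round_down (int k) (\<beta> b i))" for b
  have "finite (I \<rightarrow>\<^sub>E R)"
    using \<open>finite I\<close> by (intro finite_PiE) (auto simp: R_def finite_round_down_image)
  moreover have "card (I \<rightarrow>\<^sub>E R) \<le> 2 ^ ((k + d + 2) * card I)"
    using power_mono[OF card_round_down_image_le[of k d], of "card I"] \<open>finite I\<close>
    by (simp only: card_PiE R_def prod_constant power_mult)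
  ultimately obtain Q where Q: "cost Q \<le> (k + d + 2) * card I + c"
      "\<And>a b. msg b \<in> I \<rightarrow>\<^sub>E R \<Longrightarrow> run Q a b = run (P (msg b)) a b"
    using ex_protocol_Bob_sends[of "I \<rightarrow>\<^sub>E R" _ P c msg] cost_P by metis
  have "msg b \<in> I \<rightarrow>\<^sub>E R" if "\<forall>i\<in>I. \<bar>\<beta> b i\<bar> \<le> 2 ^ d" for b
    using that by (fastforce simp: msg_def R_def abs_le_iff)
  then show ?thesis by (intro exI[of _ Q] conjI Q(1)) (simp add: Q(2) flip: msg_def)
qed

lemma ex_protocol_inner_product:
  fixes \<alpha> :: "'a \<Rightarrow> 'i \<Rightarrow> real" and \<beta> :: "'b \<Rightarrow> 'i \<Rightarrow> real"
  assumes I: "finite I" "card I \<le> 2 ^ m"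
    and \<alpha>: "\<And>a i. a \<in> X \<Longrightarrow> i \<in> I \<Longrightarrow> \<bar>\<alpha> a i\<bar> \<le> 2 ^ c"
    and \<beta>: "\<And>b i. b \<in> Y \<Longrightarrow> i \<in> I \<Longrightarrow> \<bar>\<beta> b i\<bar> \<le> 2 ^ d"
  obtains Q where "cost Q \<le> (m + c + d + l + 4) * (card I + 1)"
    "\<And>a b. a \<in> X \<Longrightarrow> b \<in> Y \<Longrightarrow> \<bar>run Q a b - (\<Sum>i\<in>I. \<alpha> a i * \<beta> b i)\<bar> \<le> 1 / 2 ^ l"
proof -
  define val where "val s a = (\<Sum>i\<in>I. \<alpha> a i * s i)" for s a
  define msg where "msg b = (\<lambda>i\<in>I. round_down (int (m + c + Suc l)) (\<beta> b i))" for b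
  have "\<exists>Q :: ('a, 'b) protocol. cost Q \<le> Suc l + Suc (m + c + d) + 2 \<and>
      (\<forall>a b. \<bar>val s a\<bar> \<le> 2 ^ Suc (m + c + d) \<longrightarrow> \<bar>run Q a b - val s a\<bar> \<le> 1 / 2 ^ Suc l)" for s
    by (rule ex_protocol_Alice_rounds)
  then obtain P :: "('i \<Rightarrow> real) \<Rightarrow> ('a, 'b) protocol" where
    cost_P: "\<And>s. cost (P s) \<le> Suc l + Suc (m + c + d) + 2" and
    run_P: "\<And>s a b. \<bar>val s a\<bar> \<le> 2 ^ Suc (m + c + d) \<Longrightarrow>
        \<bar>run (P s) a b - val s a\<bar> \<le> 1 / 2 ^ Suc l"
    by metis
  obtain Q where cost_Q: "cost Q \<le> (m + c + Suc l + d + 2) * card I + (Suc l + Suc (m + c + d) + 2)"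
    and run_Q: "\<And>a b. \<forall>i\<in>I. \<bar>\<beta> b i\<bar> \<le> 2 ^ d \<Longrightarrow> run Q a b = run (P (msg b)) a b"
    using ex_protocol_Bob_sends_rounded[of I P, OF I(1) cost_P] unfolding msg_def by blast
  have "\<bar>run Q a b - (\<Sum>i\<in>I. \<alpha> a i * \<beta> b i)\<bar> \<le> 1 / 2 ^ l" if a: "a \<in> X" and b: "b \<in> Y" for a b
  proof -
    have msg_error: "\<bar>val (msg b) a - val (\<beta> b) a\<bar> \<le> 1 / 2 ^ Suc l"
      using abs_sum_mult_round_down_diff_le[of I m "\<alpha> a" c "Suc l" "\<beta> b", OF I(2) \<alpha>[OF a]]
      by (simp add: val_def msg_def)
    moreover have "\<bar>val (\<beta> b) a\<bar> \<le> 2 ^ (m + c + d)"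
      unfolding val_def by (rule abs_sum_mult_le_power[OF I(2) \<alpha>[OF a] \<beta>[OF b]])
    moreover have "1 / 2 ^ Suc l \<le> (1 :: real)" "(1 :: real) \<le> 2 ^ (m + c + d)"
      using one_le_power[of "2 :: real" "Suc l"] by simp_all
    ultimately have "\<bar>val (msg b) a\<bar> \<le> 2 ^ Suc (m + c + d)" unfolding power_Suc by linarith
    then have "\<bar>run Q a b - val (msg b) a\<bar> \<le> 1 / 2 ^ Suc l"
      using run_P run_Q \<beta>[OF b] by simp
    moreover have "1 / 2 ^ Suc l + 1 / 2 ^ Suc l = (1 / 2 ^ l :: real)" by simp
    ultimately have "\<bar>run Q a b - val (\<beta> b) a\<bar> \<le> 1 / 2 ^ l" using msg_error by linarith
    then show ?thesis by (simp only: val_def)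
  qed
  moreover have "cost Q \<le> (m + c + d + l + 4) * (card I + 1)"
    using cost_Q by (simp add: algebra_simps)
  ultimately show ?thesis using that by blast
qed

subsection \<open>Distributed estimation\<close>

lemma D_bar_le: "estimates n \<epsilon> f P \<Longrightarrow> D_bar n \<epsilon> f \<le> enat (cost P)"
  unfolding D_bar_def by (rule Inf_lower) blast

lemma D_bar_eq_0_if_estimates_Output: "estimates n \<epsilon> f (Output v) \<Longrightarrow> D_bar n \<epsilon> f = 0"
  using D_bar_le by (fastforce simp flip: zero_enat_def)

lemma D_bar_cube_0:
  assumes "\<epsilon> \<ge> 0"
  shows "D_bar 0 \<epsilon> f = 0"
proof -
  have "dists 0 = {return_pmf []}"
    by (auto simp: dists_def cube_def set_pmf_subset_singleton)
  then have "estimates 0 \<epsilon> f (Output (f [] []))" using assms by (auto simp: estimates_def)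
  then show ?thesis by (rule D_bar_eq_0_if_estimates_Output)
qed

lemma D_bar_approx_rank_0:
  assumes f: "\<forall>x\<in>cube n. \<forall>y\<in>cube n. \<bar>f x y\<bar> \<le> b"
    and "\<epsilon> \<ge> 0" "approx_rank n \<epsilon> f = 0"
  shows "D_bar n \<epsilon> f = 0"
proof -
  have "estimates n \<epsilon> f (Output 0)"
    using assms by (elim ex_inner_product_approx_expectation) (auto simp: estimates_def)
  then show ?thesis by (rule D_bar_eq_0_if_estimates_Output)
qed

lemma D_bar_antimono: "\<epsilon> \<le> \<delta> \<Longrightarrow> D_bar n \<delta> f \<le> D_bar n \<epsilon> f"
  unfolding D_bar_def estimates_def by (intro Inf_superset_mono) (use order_trans in blast)

lemma D_bar_le_approx_rank:
  assumes f: "\<forall>x\<in>cube n. \<forall>y\<in>cube n. \<bar>f x y\<bar> \<le> 1"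
    and \<epsilon>: "1 / 2 ^ l \<le> \<epsilon>" "\<epsilon> \<le> 1"
  shows "D_bar n \<epsilon> f \<le> enat ((n + l + 6) * (approx_rank n (\<epsilon> / 2) f + 1))"
proof -
  define r where "r = approx_rank n (\<epsilon> / 2) f"
  have "0 < 1 / (2 ^ l :: real)" by simp
  then have "0 \<le> \<epsilon> / 2" using \<epsilon>(1) by linarith
  then obtain \<alpha> \<beta> where r_le: "r \<le> 2 ^ n"
    and \<alpha>: "\<And>p i. p \<in> dists n \<Longrightarrow> i < r \<Longrightarrow> \<bar>\<alpha> p i\<bar> \<le> 1 + \<epsilon> / 2"
    and \<beta>: "\<And>q i. q \<in> dists n \<Longrightarrow> i < r \<Longrightarrow> \<bar>\<beta> q i\<bar> \<le> 1"
    and approx: "\<And>p q. p \<in> dists n \<Longrightarrow> q \<in> dists n \<Longrightarrow> \<bar>(\<Sum>i<r. \<alpha> p i * \<beta> q i) -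
        measure_pmf.expectation (pair_pmf p q) (\<lambda>(x, y). f x y)\<bar> \<le> \<epsilon> / 2"
    using ex_inner_product_approx_expectation[OF f] unfolding r_def by blast
  have \<alpha>_le: "\<bar>\<alpha> p i\<bar> \<le> 2 ^ 1" if "p \<in> dists n" "i \<in> {..<r}" for p i
    using \<alpha>[of p i] that \<epsilon>(2) by simp
  have \<beta>_le: "\<bar>\<beta> q i\<bar> \<le> 2 ^ 0" if "q \<in> dists n" "i \<in> {..<r}" for q i
    using \<beta>[of q i] that by simp
  obtain Q where cost_Q: "cost Q \<le> (n + 1 + 0 + (l + 1) + 4) * (card {..<r} + 1)"
    and run_Q: "\<And>p q. p \<in> dists n \<Longrightarrow> q \<in> dists n \<Longrightarrow>
      \<bar>run Q p q - (\<Sum>i<r. \<alpha> p i * \<beta> q i)\<bar> \<le> 1 / 2 ^ (l + 1)"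
    using ex_protocol_inner_product[of "{..<r}" n "dists n" \<alpha> 1 "dists n" \<beta> 0 "l + 1",
        OF finite_lessThan _ \<alpha>_le \<beta>_le] r_le by auto
  have precision: "1 / 2 ^ (l + 1) \<le> \<epsilon> / 2" using \<epsilon>(1) by simp
  have "estimates n \<epsilon> f Q"
    unfolding estimates_def
  proof (intro ballI)
    fix p q assume "p \<in> dists n" "q \<in> dists n"
    then show "\<bar>run Q p q - measure_pmf.expectation (pair_pmf p q) (\<lambda>(x, y). f x y)\<bar> \<le> \<epsilon>"
      using run_Q[of p q] approx[of p q] precision by linarith
  qed
  then have "D_bar n \<epsilon> f \<le> enat (cost Q)" by (rule D_bar_le)
  also have "\<dots> \<le> enat ((n + l + 6) * (r + 1))" using cost_Q by (simp add: numeral_eq_Suc)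
  finally show ?thesis by (simp add: r_def)
qed

lemma inverse_power_ceiling_log_le:
  fixes \<epsilon> :: real
  assumes "0 < \<epsilon>"
  shows "1 / 2 ^ nat \<lceil>log 2 (1 / \<epsilon>)\<rceil> \<le> \<epsilon>"
proof -
  have "1 / \<epsilon> = 2 powr log 2 (1 / \<epsilon>)" using assms by simp
  also have "\<dots> \<le> 2 powr real (nat \<lceil>log 2 (1 / \<epsilon>)\<rceil>)"
    by (intro powr_mono real_nat_ceiling_ge) simp
  also have "\<dots> = 2 ^ nat \<lceil>log 2 (1 / \<epsilon>)\<rceil>" by (simp add: powr_realpow)
  finally show ?thesis using assms by (simp add: field_simps)
qed

lemma cost_le_absorbing_constants:
  fixes n r :: nat and L :: real
  assumes "n > 0" "r > 0" "L \<ge> 0"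
  shows "real ((n + nat \<lceil>L\<rceil> + 6) * (r + 1)) \<le> 16 * (real r * real n + real r * L)"
proof -
  have "real (n + nat \<lceil>L\<rceil> + 6) \<le> 8 * real n + L" using assms by linarith
  moreover have "real (r + 1) \<le> 2 * real r" using assms by simp
  ultimately have "real ((n + nat \<lceil>L\<rceil> + 6) * (r + 1)) \<le> (8 * real n + L) * (2 * real r)"
    unfolding of_nat_mult using assms(3) by (intro mult_mono) auto
  also have "\<dots> \<le> 16 * (real r * real n + real r * L)" using assms by (simp add: algebra_simps)
  finally show ?thesis .
qed

theorem theorem2p9:
  shows "\<exists>C::real. C > 0 \<and>
    (\<forall>(n::nat) (f :: bool list \<Rightarrow> bool list \<Rightarrow> real) (\<epsilon>::real) (r::nat).
       (\<forall>x\<in>cube n. \<forall>y\<in>cube n. f x y \<in> {-1..1}) \<longrightarrow> \<epsilon> \<in> {0<..1} \<longrightarrow>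
       approx_rank n (\<epsilon> / 2) f = r \<longrightarrow>
       ereal_of_enat (D_bar n \<epsilon> f) \<le>
         ereal (C * (real r * real n + real r * log 2 (1 / \<epsilon>))))"
proof (intro exI[of _ 16] conjI allI impI)
  fix n f \<epsilon> r
  assume "\<forall>x\<in>cube n. \<forall>y\<in>cube n. f x y \<in> {-1..1}" and "\<epsilon> \<in> {0<..1}"
    and r: "approx_rank n (\<epsilon> / 2) f = r"
  then have f: "\<forall>x\<in>cube n. \<forall>y\<in>cube n. \<bar>f x y\<bar> \<le> 1" and \<epsilon>: "0 < \<epsilon>" "\<epsilon> \<le> 1"
    by (auto simp: abs_le_iff minus_le_iff)
  define L where "L = log 2 (1 / \<epsilon>)"
  have L: "L \<ge> 0" using \<epsilon> by (simp add: L_def)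
  show "ereal_of_enat (D_bar n \<epsilon> f) \<le> ereal (16 * (real r * real n + real r * log 2 (1 / \<epsilon>)))"
  proof (cases "n = 0 \<or> r = 0")
    case True
    moreover have "D_bar n \<epsilon> f \<le> D_bar n (\<epsilon> / 2) f" using \<epsilon> by (simp add: D_bar_antimono)
    ultimately have "D_bar n \<epsilon> f = 0"
      using D_bar_cube_0[of \<epsilon>] D_bar_approx_rank_0[OF f, where \<epsilon> = "\<epsilon> / 2"] r \<epsilon> by auto
    then show ?thesis using L by (simp add: L_def)
  next
    case False
    have "D_bar n \<epsilon> f \<le> enat ((n + nat \<lceil>L\<rceil> + 6) * (r + 1))"
      using D_bar_le_approx_rank[OF f inverse_power_ceiling_log_le[OF \<epsilon>(1)] \<epsilon>(2)]
      by (simp only: L_def r)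
    then have "ereal_of_enat (D_bar n \<epsilon> f) \<le> ereal (real ((n + nat \<lceil>L\<rceil> + 6) * (r + 1)))"
      by (metis ereal_of_enat_le_iff ereal_of_enat_simps(1))
    also have "\<dots> \<le> ereal (16 * (real r * real n + real r * L))"
      using False L by (intro ereal_less_eq(3)[THEN iffD2] cost_le_absorbing_constants) auto
    finally show ?thesis by (simp add: L_def)
  qed
qed simp

end
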